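(* Let $\mathcal{L}\in\{\mathrm{PL},\mathrm{PL}(\underline{\vee}),\mathrm{PD}\}$. The calculus $\mathbf{T}_{\mathcal{L}}$ is complete: every valid $\mathcal{L}$-formula $\varphi$ has a closed tableau for $\varphi$ in $\mathbf{T}_{\mathcal{L}}$.
   Context: Syntax (negation normal form): $\mathrm{PL}$: $\varphi::=p\mid\neg p\mid(\varphi\wedge\varphi)\mid(\varphi\vee\varphi)$; $\mathrm{PL}(\underline{\vee})$ adds $(\varphi\,\underline{\vee}\,\varphi)$; $\mathrm{PD}$ adds atoms ${=}(p_1,\dots,p_n,q)$. $p^\top:=p$, $p^\bot:=\neg p$. Team semantics: a team $X$ is a set of assignments $s:D\to\{0,1\}$ ($D$ a finite set of proposition symbols containing those of the formula). $X\models p$ iff $s(p)=1$ for all $s\in X$; $X\models\neg p$ iff $s(p)=0$ for all $s\in X$; $\wedge$ conjunctively; $X\models\varphi\vee\psi$ iff $X=Y\cup Z$ with $Y\models\varphi$, $Z\models\psi$; $X\models\varphi\,\underline{\vee}\,\psi$ iff $X\models\varphi$ or $X\models\psi$; $X\models{=}(p_1,\dots,p_n,q)$ iff any $s,t\in X$ agreeing on all $p_i$ agree on $q$. Valid: true in every team. $\mathrm{vrank}(\varphi)$: number of $\underline{\vee}$ in $\varphi$, where each ${=}(p_1,\dots,p_n,q)$ is counted via its replacement $\bigvee_{\vec a\in\{\bot,\top\}^n}\bigwedge\{p_1^{a_1},\dots,p_n^{a_n},(q\,\underline{\vee}\,\neg q)\}$. Labeled tableaux: labels are finite subsets of $\mathbb{N}$;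 labeled formulas $\alpha:\varphi$. A tableau is a finitely branching tree of labeled formulas built from the root by rule applications; each rule extends a branch containing its premise by alternatives (separated by $\mid$), each alternative adding all listed labeled formulas; a labeled formula is never added to a branch already containing it. Rules: (Prop) from $\{i_1,\dots,i_k\}:p$: $\{i_1\}:p\mid\dots\mid\{i_k\}:p$; ($\neg$Prop) likewise for $\neg p$; ($\wedge$) from $\alpha:(\varphi\wedge\psi)$: $\alpha:\varphi\mid\alpha:\psi$; ($\vee$) from $\alpha:(\varphi\vee\psi)$ and any $\beta\subseteq\alpha$: $\beta:\varphi\mid\alpha\setminus\beta:\psi$; ($\underline{\vee}$) from $\alpha:(\varphi\,\underline{\vee}\,\psi)$: add $\alpha:\varphi$ and $\alpha:\psi$; (Split) from $\alpha:{=}(\vec p,q)$: $\alpha_1:{=}(\vec p,q)\mid\dots\mid\alpha_k:{=}(\vec p,q)$ with $\alpha_1,\dots,\alpha_k$ all 2-element subsets of $\alpha$; (PL dep) from $\{i_1,i_2\}:{=}(p_1,\dots,p_n,q)$: one alternative per $g:\{1,\dots,n\}\to\{\top,\bot\}$ adding $\{i_1\}:p_m^{g(m)},\{i_2\}:p_m^{g(m)}$ ($m\le n$), $\{i_1,i_2\}:q$, $\{i_1,i_2\}:\neg q$. $\mathbf{T}_{\mathrm{PL}}$ = (Prop), ($\neg$Prop), ($\wedge$), ($\vee$); $\mathbf{T}_{\mathrm{PL}(\underline{\vee})}$ adds ($\underline{\vee}$); $\mathbf{T}_{\mathrm{PD}}$ adds (Split), (PL dep) to $\mathbf{T}_{\mathrm{PL}}$.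 A tableau for $\varphi$ in $\mathbf{T}_{\mathcal{L}}$ has root $\{1,\dots,2^{\mathrm{vrank}(\varphi)}\}:\varphi$ and uses rules of $\mathbf{T}_{\mathcal{L}}$. A branch is closed if it contains (1) both $\alpha:p$ and $\alpha:\neg p$, or (2) $\emptyset:\psi$ for some $\psi$, or (3) $\{i\}:{=}(p_1,\dots,p_n,q)$ for some $i$; a tableau is closed if all its branches are closed. *)

theory Defs
  imports Main
begin

datatype 'p form =
    Pos 'p
  | Neg 'p
  | And "'p form" "'p form"
  | Or "'p form" "'p form"
  | IOr "'p form" "'p form"  \<comment> \<open>intuitionistic (Boolean) disjunction\<close>
  | Dep "'p list" 'p  \<comment> \<open>the list may be empty: constancy atom\<close>

datatype lang = PL | PLI | PD

fun in_lang :: "lang \<Rightarrow> 'p form \<Rightarrow> bool" where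
  "in_lang L (Pos p) = True"
| "in_lang L (Neg p) = True"
| "in_lang L (And \<phi> \<psi>) = (in_lang L \<phi> \<and> in_lang L \<psi>)"
| "in_lang L (Or \<phi> \<psi>) = (in_lang L \<phi> \<and> in_lang L \<psi>)"
| "in_lang L (IOr \<phi> \<psi>) = (L = PLI \<and> in_lang L \<phi> \<and> in_lang L \<psi>)"
| "in_lang L (Dep ps q) = (L = PD)"

fun props :: "'p form \<Rightarrow> 'p set" where
  "props (Pos p) = {p}"
| "props (Neg p) = {p}"
| "props (And \<phi> \<psi>) = props \<phi> \<union> props \<psi>"
| "props (Or \<phi> \<psi>) = props \<phi> \<union> props \<psi>"
| "props (IOr \<phi> \<psi>) = props \<phi> \<union> props \<psi>"
| "props (Dep ps q) = insert q (set ps)"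

text \<open>An assignment over \<open>D\<close> is a partial map with domain exactly \<open>D\<close>.\<close>

type_synonym 'p team = "('p \<rightharpoonup> bool) set"

definition team_on :: "'p set \<Rightarrow> 'p team \<Rightarrow> bool" where
  "team_on D X \<longleftrightarrow> (\<forall>s\<in>X. dom s = D)"

fun sat :: "'p team \<Rightarrow> 'p form \<Rightarrow> bool" where
  "sat X (Pos p) = (\<forall>s\<in>X. s p = Some True)"
| "sat X (Neg p) = (\<forall>s\<in>X. s p = Some False)"
| "sat X (And \<phi> \<psi>) = (sat X \<phi> \<and> sat X \<psi>)"
| "sat X (Or \<phi> \<psi>) = (\<exists>Y Z. X = Y \<union> Z \<and> sat Y \<phi> \<and> sat Z \<psi>)"
| "sat X (IOr \<phi> \<psi>) = (sat X \<phi> \<or> sat X \<psi>)"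
| "sat X (Dep ps q) = (\<forall>s\<in>X. \<forall>t\<in>X. (\<forall>p\<in>set ps. s p = t p) \<longrightarrow> s q = t q)"

definition valid :: "'p form \<Rightarrow> bool" where
  "valid \<phi> \<longleftrightarrow>
    (\<forall>D X. finite D \<longrightarrow> props \<phi> \<subseteq> D \<longrightarrow> team_on D X \<longrightarrow> sat X \<phi>)"

fun lit :: "'p \<Rightarrow> bool \<Rightarrow> 'p form" where
  "lit p True = Pos p"
| "lit p False = Neg p"

fun big_or :: "'p form list \<Rightarrow> 'p form" where  \<comment> \<open>only used on nonempty lists\<close>
  "big_or [\<phi>] = \<phi>"
| "big_or (\<phi> # \<psi> # \<chi>s) = Or \<phi> (big_or (\<psi> # \<chi>s))"

definition dep_def :: "'p list \<Rightarrow> 'p \<Rightarrow> 'p form" where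
  "dep_def ps q =
    big_or (map (\<lambda>as. foldr And (map2 lit ps as) (IOr (Pos q) (Neg q)))
                (List.n_lists (length ps) [False, True]))"

fun expand_dep :: "'p form \<Rightarrow> 'p form" where
  "expand_dep (And \<phi> \<psi>) = And (expand_dep \<phi>) (expand_dep \<psi>)"
| "expand_dep (Or \<phi> \<psi>) = Or (expand_dep \<phi>) (expand_dep \<psi>)"
| "expand_dep (IOr \<phi> \<psi>) = IOr (expand_dep \<phi>) (expand_dep \<psi>)"
| "expand_dep (Dep ps q) = dep_def ps q"
| "expand_dep \<phi> = \<phi>"

fun count_ior :: "'p form \<Rightarrow> nat" where
  "count_ior (And \<phi> \<psi>) = count_ior \<phi> + count_ior \<psi>"
| "count_ior (Or \<phi> \<psi>) = count_ior \<phi> + count_ior \<psi>"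
| "count_ior (IOr \<phi> \<psi>) = Suc (count_ior \<phi> + count_ior \<psi>)"
| "count_ior _ = 0"

definition vrank :: "'p form \<Rightarrow> nat" where
  "vrank \<phi> = count_ior (expand_dep \<phi>)"

lemma vrank_Dep:
  fixes ps :: "'p list"
  shows "vrank (Dep ps q) = 2 ^ length ps"
proof -
  have lit: "count_ior (lit p b) = 0" for p :: 'p and b
    by (cases b) auto
  have conj: "count_ior (foldr And (map2 lit ps as) \<phi>) = count_ior \<phi>"
    for ps :: "'p list" and as and \<phi> :: "'p form"
    by (induction ps as rule: list_induct2') (auto simp: lit)
  have disj: "\<phi>s \<noteq> [] \<Longrightarrow> count_ior (big_or \<phi>s) = sum_list (map count_ior \<phi>s)"
    for \<phi>s :: "'p form list"
    by (induction \<phi>s rule: big_or.induct) auto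
  have len: "length (List.n_lists (length ps) [False, True]) = 2 ^ length ps"
    by (simp add: length_n_lists numeral_2_eq_2)
  then have "List.n_lists (length ps) [False, True] \<noteq> []"
    by (metis list.size(3) power_not_zero zero_neq_numeral)
  then show ?thesis
    by (simp add: vrank_def dep_def_def disj comp_def conj sum_list_triv len)
qed

type_synonym 'p lform = "nat set \<times> 'p form"

text \<open>\<open>tab_rule L c alts\<close>: in the calculus for \<open>L\<close>, the premise \<open>c\<close> yields the
  alternatives \<open>alts\<close>, each being the list of labeled formulas it adds.\<close>

inductive tab_rule :: "lang \<Rightarrow> 'p lform \<Rightarrow> 'p lform list list \<Rightarrow> bool" for L where
  Prop: "is \<noteq> [] \<Longrightarrow> distinct is \<Longrightarrow>
    tab_rule L (set is, Pos p) (map (\<lambda>i. [({i}, Pos p)]) is)"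
| NProp: "is \<noteq> [] \<Longrightarrow> distinct is \<Longrightarrow>
    tab_rule L (set is, Neg p) (map (\<lambda>i. [({i}, Neg p)]) is)"
| And: "tab_rule L (\<alpha>, And \<phi> \<psi>) [[(\<alpha>, \<phi>)], [(\<alpha>, \<psi>)]]"
| Or: "\<beta> \<subseteq> \<alpha> \<Longrightarrow> tab_rule L (\<alpha>, Or \<phi> \<psi>) [[(\<beta>, \<phi>)], [(\<alpha> - \<beta>, \<psi>)]]"
| IOr: "L = PLI \<Longrightarrow> tab_rule L (\<alpha>, IOr \<phi> \<psi>) [[(\<alpha>, \<phi>), (\<alpha>, \<psi>)]]"
| Split: "L = PD \<Longrightarrow> \<alpha>s \<noteq> [] \<Longrightarrow> distinct \<alpha>s \<Longrightarrow> set \<alpha>s = {\<beta>. \<beta> \<subseteq> \<alpha> \<and> card \<beta> = 2} \<Longrightarrow>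
    tab_rule L (\<alpha>, Dep ps q) (map (\<lambda>\<beta>. [(\<beta>, Dep ps q)]) \<alpha>s)"
| PLdep: "L = PD \<Longrightarrow> i \<noteq> j \<Longrightarrow>
    tab_rule L ({i, j}, Dep ps q)
      (map (\<lambda>g. map (Pair {i}) (map2 lit ps g) @ map (Pair {j}) (map2 lit ps g) @
                [({i, j}, Pos q), ({i, j}, Neg q)])
           (List.n_lists (length ps) [False, True]))"

datatype 'p tree = Node "'p lform" "'p tree list"

fun chain :: "'p lform list \<Rightarrow> 'p tree" where  \<comment> \<open>only used on nonempty lists\<close>
  "chain [x] = Node x []"
| "chain (x # y # zs) = Node x [chain (y # zs)]"

text \<open>\<open>grow L B t t'\<close>: \<open>t'\<close> arises from \<open>t\<close> by one rule application at the end of a branch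
  of \<open>t\<close>, where \<open>B\<close> is the set of labeled formulas above the root of \<open>t\<close>. Formulas already on
  the branch are dropped from each alternative. An application in which some alternative would
  add nothing is excluded; it would leave the branch as it is among its alternatives, so it cannot
  contribute to closing the branch.\<close>

inductive grow :: "lang \<Rightarrow> 'p lform set \<Rightarrow> 'p tree \<Rightarrow> 'p tree \<Rightarrow> bool" for L where
  leaf: "c \<in> insert x B \<Longrightarrow> tab_rule L c alts \<Longrightarrow>
    news = map (\<lambda>ys. remdups (filter (\<lambda>y. y \<notin> insert x B) ys)) alts \<Longrightarrow>
    [] \<notin> set news \<Longrightarrow>
    grow L B (Node x []) (Node x (map chain news))"
| inner: "grow L (insert x B) t t' \<Longrightarrow>
    grow L B (Node x (ts @ t # us)) (Node x (ts @ t' # us))"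

inductive tableau :: "lang \<Rightarrow> 'p form \<Rightarrow> 'p tree \<Rightarrow> bool" for L \<phi> where
  root: "tableau L \<phi> (Node ({1..2 ^ vrank \<phi>}, \<phi>) [])"
| step: "tableau L \<phi> t \<Longrightarrow> grow L {} t t' \<Longrightarrow> tableau L \<phi> t'"

fun branches :: "'p tree \<Rightarrow> 'p lform list set" where
  "branches (Node x ts) = (if ts = [] then {[x]} else (#) x ` (\<Union>t\<in>set ts. branches t))"

definition closed_branch :: "'p lform list \<Rightarrow> bool" where
  "closed_branch b \<longleftrightarrow>
    (\<exists>\<alpha> p. (\<alpha>, Pos p) \<in> set b \<and> (\<alpha>, Neg p) \<in> set b) \<or>
    (\<exists>\<psi>. ({}, \<psi>) \<in> set b) \<or>
    (\<exists>i ps q. ({i}, Dep ps q) \<in> set b)"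

definition closed_tableau :: "'p tree \<Rightarrow> bool" where
  "closed_tableau t \<longleftrightarrow> (\<forall>b\<in>branches t. closed_branch b)"

end

theory Submission
  imports Defs
begin

text \<open>A branch stays inside a finite set of labeled formulas and every useful rule application
  enlarges it, so it can be extended until it is closed or saturated. On a saturated open branch
  let \<open>i\<close> denote the assignment making \<open>p\<close> false iff \<open>{i} : p\<close> is on the branch. Then for every
  \<open>\<alpha> : \<chi>\<close> on the branch the team denoted by \<open>\<alpha>\<close> falsifies \<open>\<chi>\<close>; for \<open>\<chi> = \<psi>\<^sub>1 \<or> \<psi>\<^sub>2\<close>
  this uses downward closure. A branch starting with a valid formula can therefore be closed.\<close>

section \<open>Closing a branch relative to the formulas above a subtree\<close>

definition closed_set :: "'p lform set \<Rightarrow> bool" where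
  "closed_set S \<longleftrightarrow>
    (\<exists>\<alpha> p. (\<alpha>, Pos p) \<in> S \<and> (\<alpha>, Neg p) \<in> S) \<or>
    (\<exists>\<psi>. ({}, \<psi>) \<in> S) \<or>
    (\<exists>i ps q. ({i}, Dep ps q) \<in> S)"

text \<open>A rule counts as used once a single alternative lies entirely in the set. This is
  exactly the situation in which \<open>grow\<close> forbids the application, so a branch that is
  not saturated always admits a permitted one.\<close>

definition saturated :: "lang \<Rightarrow> 'p lform set \<Rightarrow> bool" where
  "saturated L S \<longleftrightarrow>
    (\<forall>c\<in>S. \<forall>alts. tab_rule L c alts \<longrightarrow> (\<exists>ys\<in>set alts. set ys \<subseteq> S))"

lemma saturatedD:
  "saturated L S \<Longrightarrow> c \<in> S \<Longrightarrow> tab_rule L c alts \<Longrightarrow> \<exists>ys\<in>set alts. set ys \<subseteq> S"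
  by (simp add: saturated_def)

text \<open>Here \<open>S\<close> collects the formulas above the root of \<open>t\<close>, so the
  notion applies to a subtree in the middle of a tableau; the whole tableau is the case
  \<open>S = {}\<close>.\<close>

definition closable :: "lang \<Rightarrow> 'p lform set \<Rightarrow> 'p tree \<Rightarrow> bool" where
  "closable L S t \<longleftrightarrow>
    (\<exists>t'. (grow L S)\<^sup>*\<^sup>* t t' \<and> (\<forall>b\<in>branches t'. closed_set (S \<union> set b)))"

lemma closed_branch_iff: "closed_branch b \<longleftrightarrow> closed_set (set b)"
  by (simp add: closed_branch_def closed_set_def)

lemma closable_step: "grow L S t t' \<Longrightarrow> closable L S t' \<Longrightarrow> closable L S t"
  unfolding closable_def by (meson converse_rtranclp_into_rtranclp)

lemma closable_leaf: "closed_set (insert x S) \<Longrightarrow> closable L S (Node x [])"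
  unfolding closable_def by (intro exI[of _ "Node x []"]) simp

lemma grow_rtranclp_inner:
  assumes "(grow L (insert x S))\<^sup>*\<^sup>* t t'"
  shows "(grow L S)\<^sup>*\<^sup>* (Node x (ts @ t # us)) (Node x (ts @ t' # us))"
  using assms by induction (simp, erule rtranclp.rtrancl_into_rtrancl, erule grow.inner)

text \<open>The prefix \<open>us\<close> is kept general because the children are grown from left to
  right and the finished ones accumulate there.\<close>

lemma grow_rtranclp_children:
  assumes "list_all2 (grow L (insert x S))\<^sup>*\<^sup>* ts ts'"
  shows "(grow L S)\<^sup>*\<^sup>* (Node x (us @ ts)) (Node x (us @ ts'))"
  using assms
proof (induction arbitrary: us rule: list_all2_induct)
  case (Cons t ts t' ts')
  have "(grow L S)\<^sup>*\<^sup>* (Node x (us @ t # ts)) (Node x (us @ t' # ts))"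
    using Cons.hyps(1) by (rule grow_rtranclp_inner)
  also have "(grow L S)\<^sup>*\<^sup>* (Node x (us @ t' # ts)) (Node x (us @ t' # ts'))"
    using Cons.IH[of "us @ [t']"] by simp
  finally show ?case .
qed simp

text \<open>Growth inside a child sees only \<open>insert x S\<close> and never the siblings, so
  closing growths of the individual children can be run one after another.\<close>

lemma closable_Node:
  assumes "ts \<noteq> []" and "\<And>t. t \<in> set ts \<Longrightarrow> closable L (insert x S) t"
  shows "closable L S (Node x ts)"
proof -
  have "\<forall>t\<in>set ts. \<exists>t'. (grow L (insert x S))\<^sup>*\<^sup>* t t' \<and>
      (\<forall>b\<in>branches t'. closed_set (insert x S \<union> set b))"
    using assms(2) unfolding closable_def by blast
  then obtain h where h: "\<And>t. t \<in> set ts \<Longrightarrow> (grow L (insert x S))\<^sup>*\<^sup>* t (h t)"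
    "\<And>t b. t \<in> set ts \<Longrightarrow> b \<in> branches (h t) \<Longrightarrow> closed_set (insert x S \<union> set b)"
    by metis
  have "list_all2 (grow L (insert x S))\<^sup>*\<^sup>* ts (map h ts)"
    using h(1) by (simp add: list_all2_conv_all_nth)
  then have "(grow L S)\<^sup>*\<^sup>* (Node x ts) (Node x (map h ts))"
    using grow_rtranclp_children[of L x S ts "map h ts" "[]"] by simp
  moreover have "\<forall>b\<in>branches (Node x (map h ts)). closed_set (S \<union> set b)"
    using h(2) assms(1) by auto
  ultimately show ?thesis
    unfolding closable_def by blast
qed

text \<open>An alternative is appended as a path that is extended only at its last node. The
  hypothesis covers every way of singling out a leaf from \<open>S \<union> set ys\<close>, so the
  induction need not track which formula comes last.\<close>

lemma closable_chain:
  assumes "ys \<noteq> []" and "\<And>x S'. insert x S' = S \<union> set ys \<Longrightarrow> closable L S' (Node x [])"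
  shows "closable L S (chain ys)"
  using assms
proof (induction ys arbitrary: S rule: chain.induct)
  case (1 x)
  then show ?case by simp
next
  case (2 x y zs)
  have "closable L (insert x S) (chain (y # zs))"
  proof (rule "2.IH")
    fix z S'
    assume "insert z S' = insert x S \<union> set (y # zs)"
    then show "closable L S' (Node z [])"
      by (intro "2.prems"(2)) auto
  qed simp
  then show ?case
    using closable_Node[of "[chain (y # zs)]"] by simp
qed simp

section \<open>Extending branches until they are saturated\<close>

text \<open>An application without alternatives would leave a leaf behind, whereas
  \<open>closable_Node\<close> needs at least one child.\<close>

lemma tab_rule_alts_nonempty: "tab_rule L c alts \<Longrightarrow> alts \<noteq> []"
proof (induction rule: tab_rule.induct)
  case (PLdep i j ps q)
  have "length (List.n_lists (length ps) [False, True]) \<noteq> 0"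
    by (simp add: length_n_lists)
  then show ?case
    by auto
qed auto

text \<open>Induction on the number of formulas of \<open>U\<close> still missing from the branch:
  every alternative of a permitted application adds a new one. The last hypothesis concerns only
  sets above \<open>insert x S\<close>, so it passes to extensions of the branch.\<close>

lemma closable_by_saturation:
  assumes "finite U"
    and U: "\<And>c alts ys. c \<in> U \<Longrightarrow> tab_rule L c alts \<Longrightarrow> ys \<in> set alts \<Longrightarrow> set ys \<subseteq> U"
    and "insert x S \<subseteq> U"
    and "\<And>S'. insert x S \<subseteq> S' \<Longrightarrow> S' \<subseteq> U \<Longrightarrow> saturated L S' \<Longrightarrow> closed_set S'"
  shows "closable L S (Node x [])"
  using assms(3,4)
proof (induction "card (U - insert x S)" arbitrary: x S rule: less_induct)
  case less
  show ?case
  proof (cases "saturated L (insert x S)")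
    case True
    then show ?thesis
      using less.prems by (intro closable_leaf) auto
  next
    case False
    then obtain c alts where c: "c \<in> insert x S" "tab_rule L c alts"
      and new: "\<And>ys. ys \<in> set alts \<Longrightarrow> \<not> set ys \<subseteq> insert x S"
      unfolding saturated_def by blast
    define news where "news = map (\<lambda>ys. remdups (filter (\<lambda>y. y \<notin> insert x S) ys)) alts"
    \<comment> \<open>No alternative is contained in the branch, so each keeps a formula after those
      already present are dropped.\<close>
    have nonempty: "[] \<notin> set news"
      using new by (fastforce simp: news_def filter_empty_conv)
    have "grow L S (Node x []) (Node x (map chain news))"
      using c news_def nonempty by (rule grow.leaf)
    moreover have "closable L S (Node x (map chain news))"
    proof (rule closable_Node)
      show "map chain news \<noteq> []"
        using tab_rule_alts_nonempty[OF c(2)] by (simp add: news_def)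
    next
      fix t
      assume "t \<in> set (map chain news)"
      then obtain zs where zs: "zs \<in> set news" "t = chain zs"
        by auto
      then obtain ys where ys: "ys \<in> set alts"
        "zs = remdups (filter (\<lambda>y. y \<notin> insert x S) ys)"
        unfolding news_def set_map by blast
      then have set_zs: "set zs = set ys - insert x S"
        by auto
      have zsU: "set zs \<subseteq> U"
        using U[OF _ c(2) ys(1)] c(1) less.prems(1) set_zs by blast
      have "zs \<noteq> []"
        using zs(1) nonempty by auto
      then have "closable L (insert x S) (chain zs)"
      proof (rule closable_chain)
        fix y S'
        assume eq: "insert y S' = insert x S \<union> set zs"
        have "insert x S \<subset> insert y S'"
          using eq set_zs new[OF ys(1)] by auto
        then have "U - insert y S' \<subset> U - insert x S"
          using eq zsU by blast
        then have "card (U - insert y S') < card (U - insert x S)"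
          using assms(1) by (intro psubset_card_mono) auto
        then show "closable L S' (Node y [])"
        proof (rule less.hyps)
          show "insert y S' \<subseteq> U"
            using eq zsU less.prems(1) by simp
        next
          fix S''
          assume "insert y S' \<subseteq> S''" "S'' \<subseteq> U" "saturated L S''"
          then show "closed_set S''"
            using eq by (intro less.prems(2)) auto
        qed
      qed
      then show "closable L (insert x S) t"
        using zs(2) by simp
    qed
    ultimately show ?thesis
      by (rule closable_step)
  qed
qed

section \<open>A finite universe closed under the rules\<close>

text \<open>Subformulas alone do not suffice: (PL dep) introduces literals of both signs for the
  symbols of a dependence atom.\<close>

fun clos :: "'p form \<Rightarrow> 'p form set" where
  "clos (And \<phi> \<psi>) = insert (And \<phi> \<psi>) (clos \<phi> \<union> clos \<psi>)"
| "clos (Or \<phi> \<psi>) = insert (Or \<phi> \<psi>) (clos \<phi> \<union> clos \<psi>)"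
| "clos (IOr \<phi> \<psi>) = insert (IOr \<phi> \<psi>) (clos \<phi> \<union> clos \<psi>)"
| "clos (Dep ps q) = insert (Dep ps q) (Pos ` insert q (set ps) \<union> Neg ` insert q (set ps))"
| "clos \<phi> = {\<phi>}"

lemma finite_clos: "finite (clos \<phi>)"
  by (induction \<phi>) auto

lemma clos_self: "\<phi> \<in> clos \<phi>"
  by (cases \<phi>) auto

lemma clos_trans: "\<chi> \<in> clos \<psi> \<Longrightarrow> \<psi> \<in> clos \<phi> \<Longrightarrow> \<chi> \<in> clos \<phi>"
  by (induction \<phi>) auto

lemma lit_cases: "lit p b = Pos p \<or> lit p b = Neg p"
  by (cases b) auto

lemma map2_lit_clos: "set (map2 lit ps g) \<subseteq> clos (Dep ps q)"
  using lit_cases by (fastforce dest: set_zip_leftD)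

text \<open>This subformula property confines every branch to the finite set
  \<open>Pow A \<times> clos \<phi>\<close>, where \<open>A\<close> is the label of the
  root.\<close>

lemma tab_rule_clos:
  assumes "tab_rule L (\<alpha>, \<chi>) alts" and "ys \<in> set alts" and "(\<beta>, \<psi>) \<in> set ys"
  shows "\<beta> \<subseteq> \<alpha> \<and> \<psi> \<in> clos \<chi>"
  using assms
proof (cases rule: tab_rule.cases)
  case (PLdep i j ps q)
  then obtain g where "ys = map (Pair {i}) (map2 lit ps g) @ map (Pair {j}) (map2 lit ps g) @
      [({i, j}, Pos q), ({i, j}, Neg q)]"
    using assms(2) by auto
  then have "\<beta> \<subseteq> {i, j}" and "\<psi> \<in> set (map2 lit ps g) \<or> \<psi> \<in> {Pos q, Neg q}"
    using assms(3) by auto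
  then show ?thesis
    using map2_lit_clos[of ps g q] PLdep by auto
qed (auto simp: clos_self)

section \<open>Falsifying teams from saturated open branches\<close>

lemma sat_downward: "sat X \<phi> \<Longrightarrow> Y \<subseteq> X \<Longrightarrow> sat Y \<phi>"
proof (induction \<phi> arbitrary: X Y)
  case (Or \<phi> \<psi>)
  then obtain A B where "X = A \<union> B" "sat A \<phi>" "sat B \<psi>"
    by auto
  then have "Y = (A \<inter> Y) \<union> (B \<inter> Y)" "sat (A \<inter> Y) \<phi>" "sat (B \<inter> Y) \<psi>"
    using Or by auto
  then show ?case
    unfolding sat.simps by blast
next
  case (Dep ps q)
  then show ?case
    by (simp add: subset_iff)
qed auto

text \<open>Labels with at most one element close the set by definition; a larger one is cut down to
  a pair by (Split), and then (PL dep) applies. So dependence atoms with finite labels never occur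
  in a saturated open set for \<open>PD\<close>.\<close>

lemma saturated_Dep_closed:
  assumes "saturated PD S" and "(\<alpha>, Dep ps q) \<in> S" and "finite \<alpha>"
  shows "closed_set S"
proof -
  consider "\<alpha> = {}" | i where "\<alpha> = {i}" | "card \<alpha> \<ge> 2"
    using assms(3) by (metis One_nat_def Suc_1 card_0_eq card_1_singletonE less_2_cases not_less)
  then show ?thesis
  proof cases
    case 3
    let ?B = "{\<beta>. \<beta> \<subseteq> \<alpha> \<and> card \<beta> = 2}"
    have "finite ?B" "?B \<noteq> {}"
      using assms(3) obtain_subset_with_card_n[OF 3] by auto
    then obtain \<alpha>s where "\<alpha>s \<noteq> []" "distinct \<alpha>s" "set \<alpha>s = ?B"
      by (metis (no_types, lifting) finite_distinct_list list.set(1))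
    then have "tab_rule PD (\<alpha>, Dep ps q) (map (\<lambda>\<beta>. [(\<beta>, Dep ps q)]) \<alpha>s)"
      by (intro tab_rule.Split) auto
    from saturatedD[OF assms(1,2) this]
    obtain \<beta> where "\<beta> \<in> set \<alpha>s" "(\<beta>, Dep ps q) \<in> S"
      by auto
    then obtain i j where ij: "({i, j}, Dep ps q) \<in> S" "i \<noteq> j"
      using \<open>set \<alpha>s = ?B\<close> by (auto simp: card_2_iff)
    \<comment> \<open>Every alternative of (PL dep) closes the branch by itself, since it contains both
      \<open>{i, j} : q\<close> and \<open>{i, j} : \<not>q\<close>.\<close>
    have "({i, j}, Pos q) \<in> S" "({i, j}, Neg q) \<in> S"
      using saturatedD[OF assms(1) ij(1) tab_rule.PLdep[OF refl ij(2)]] by auto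
    then show ?thesis
      unfolding closed_set_def by blast
  qed (use assms(2) in \<open>auto simp: closed_set_def\<close>)
qed

lemma saturated_Pos:
  assumes "saturated L S" and "(\<alpha>, Pos p) \<in> S" and "finite \<alpha>" and "\<alpha> \<noteq> {}"
  shows "\<exists>i\<in>\<alpha>. ({i}, Pos p) \<in> S"
proof -
  obtain l where l: "l \<noteq> []" "distinct l" "set l = \<alpha>"
    using assms(3,4) by (metis finite_distinct_list list.set(1))
  show ?thesis
    using saturatedD[OF assms(1) _ tab_rule.Prop[OF l(1,2)], of p] assms(2) l(3) by auto
qed

lemma saturated_Neg:
  assumes "saturated L S" and "(\<alpha>, Neg p) \<in> S" and "finite \<alpha>" and "\<alpha> \<noteq> {}"
  shows "\<exists>i\<in>\<alpha>. ({i}, Neg p) \<in> S"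
proof -
  obtain l where l: "l \<noteq> []" "distinct l" "set l = \<alpha>"
    using assms(3,4) by (metis finite_distinct_list list.set(1))
  show ?thesis
    using saturatedD[OF assms(1) _ tab_rule.NProp[OF l(1,2)], of p] assms(2) l(3) by auto
qed

lemma saturated_open_falsifies:
  fixes f :: "nat \<Rightarrow> 'p \<rightharpoonup> bool"
  assumes S: "saturated L S" "\<not> closed_set S"
    and fin: "\<And>\<alpha> \<chi>. (\<alpha>, \<chi>) \<in> S \<Longrightarrow> finite \<alpha>"
    and f: "\<And>i p. p \<in> D \<Longrightarrow> f i p = Some (({i}, Pos p) \<notin> S)"
    and "(\<alpha>, \<chi>) \<in> S" and "in_lang L \<chi>" and "props \<chi> \<subseteq> D"
  shows "\<not> sat (f ` \<alpha>) \<chi>"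
  using assms(5-7)
proof (induction \<chi> arbitrary: \<alpha>)
  case (Pos p)
  \<comment> \<open>The empty team satisfies every literal; openness of \<open>S\<close> excludes
    the empty label.\<close>
  have "\<alpha> \<noteq> {}"
    using S(2) Pos.prems(1) by (auto simp: closed_set_def)
  then obtain i where "i \<in> \<alpha>" "({i}, Pos p) \<in> S"
    using saturated_Pos[OF S(1) Pos.prems(1) fin[OF Pos.prems(1)]] by blast
  then show ?case
    using f[of p i] Pos.prems(3) by (auto intro!: bexI[of _ i])
next
  case (Neg p)
  have "\<alpha> \<noteq> {}"
    using S(2) Neg.prems(1) by (auto simp: closed_set_def)
  then obtain i where i: "i \<in> \<alpha>" "({i}, Neg p) \<in> S"
    using saturated_Neg[OF S(1) Neg.prems(1) fin[OF Neg.prems(1)]] by blast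
  \<comment> \<open>The assignments are read off from positive literals alone; openness at the label
    \<open>{i}\<close> is what makes \<open>f i p\<close> true here.\<close>
  then have "({i}, Pos p) \<notin> S"
    using S(2) unfolding closed_set_def by blast
  then show ?case
    using i(1) f[of p i] Neg.prems(3) by (auto intro!: bexI[of _ i])
next
  case (And \<phi> \<psi>)
  have "(\<alpha>, \<phi>) \<in> S \<or> (\<alpha>, \<psi>) \<in> S"
    using saturatedD[OF S(1) And.prems(1) tab_rule.And] by simp
  then show ?case
    using And.IH[of \<alpha>] And.prems(2,3) by auto
next
  case (Or \<phi> \<psi>)
  show ?case
  proof
    assume "sat (f ` \<alpha>) (Or \<phi> \<psi>)"
    then obtain Y Z where YZ: "f ` \<alpha> = Y \<union> Z" "sat Y \<phi>" "sat Z \<psi>"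
      by auto
    \<comment> \<open>Saturation covers the disjunction rule for every subset of the label, so the
      subset can be chosen to fit the given \<open>Y\<close> and \<open>Z\<close>. Where these
      overlap, all indices go to \<beta>, so the rest may denote a proper subset of
      \<open>Z\<close>; downward closure absorbs this.\<close>
    define \<beta> where "\<beta> = {i \<in> \<alpha>. f i \<in> Y}"
    have "f ` \<beta> \<subseteq> Y" "f ` (\<alpha> - \<beta>) \<subseteq> Z"
      using YZ(1) unfolding \<beta>_def by blast+
    then have "sat (f ` \<beta>) \<phi>" "sat (f ` (\<alpha> - \<beta>)) \<psi>"
      using YZ(2,3) sat_downward by metis+
    moreover have "\<beta> \<subseteq> \<alpha>"
      unfolding \<beta>_def by blast
    then have "(\<beta>, \<phi>) \<in> S \<or> (\<alpha> - \<beta>, \<psi>) \<in> S"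
      using saturatedD[OF S(1) Or.prems(1) tab_rule.Or[of \<beta>]] by simp
    ultimately show False
      using Or.IH(1)[of \<beta>] Or.IH(2)[of "\<alpha> - \<beta>"] Or.prems(2,3) by auto
  qed
next
  case (IOr \<phi> \<psi>)
  have "(\<alpha>, \<phi>) \<in> S \<and> (\<alpha>, \<psi>) \<in> S"
    using saturatedD[OF S(1) IOr.prems(1) tab_rule.IOr] IOr.prems(2) by simp
  then show ?case
    using IOr.IH[of \<alpha>] IOr.prems(2,3) by auto
next
  case (Dep ps q)
  \<comment> \<open>Membership in the language forces \<open>L = PD\<close>, and then the atom would
    close \<open>S\<close>, so this case is contradictory.\<close>
  then have "saturated PD S"
    using S(1) by simp
  then show ?case
    using saturated_Dep_closed[OF _ Dep.prems(1) fin[OF Dep.prems(1)]] S(2) by blast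
qed

lemma finite_props: "finite (props \<phi>)"
  by (induction \<phi>) auto

lemma tableau_rtranclp: "(grow L {})\<^sup>*\<^sup>* t t' \<Longrightarrow> tableau L \<phi> t \<Longrightarrow> tableau L \<phi> t'"
  by (induction rule: rtranclp_induct) (auto intro: tableau.step)

theorem theorem5:
  fixes L :: lang and \<phi> :: "'p form"
  assumes "in_lang L \<phi>" and "valid \<phi>"
  shows "\<exists>t. tableau L \<phi> t \<and> closed_tableau t"
proof -
  define A :: "nat set" where "A = {1..2 ^ vrank \<phi>}"
  have "closable L {} (Node (A, \<phi>) [])"
  proof (rule closable_by_saturation[where U = "Pow A \<times> clos \<phi>"])
    show "finite (Pow A \<times> clos \<phi>)"
      by (simp add: A_def finite_clos)
  next
    fix c alts ys
    assume "c \<in> Pow A \<times> clos \<phi>" "tab_rule L c alts" "ys \<in> set alts"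
    then show "set ys \<subseteq> Pow A \<times> clos \<phi>"
      by (cases c) (auto dest!: tab_rule_clos intro: clos_trans)
  next
    show "{(A, \<phi>)} \<subseteq> Pow A \<times> clos \<phi>"
      by (simp add: clos_self)
  next
    fix S
    assume S: "{(A, \<phi>)} \<subseteq> S" "S \<subseteq> Pow A \<times> clos \<phi>" "saturated L S"
    show "closed_set S"
    proof (rule ccontr)
      assume "\<not> closed_set S"
      \<comment> \<open>The default \<open>None\<close> gives each assignment exactly the domain
        \<open>props \<phi>\<close>, so validity can be applied to this team.\<close>
      define f where
        "f = (\<lambda>i p. if p \<in> props \<phi> then Some (({i}, Pos p) \<notin> S) else None)"
      have "finite \<alpha>" if "(\<alpha>, \<chi>) \<in> S" for \<alpha> \<chi>
        using that S(2) by (auto simp: A_def intro: finite_subset)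
      then have "\<not> sat (f ` A) \<phi>"
        using S(1) assms(1)
        by (intro saturated_open_falsifies[OF S(3) \<open>\<not> closed_set S\<close>]) (auto simp: f_def)
      moreover have "team_on (props \<phi>) (f ` A)"
        by (auto simp: team_on_def f_def split: if_splits)
      ultimately show False
        using assms(2) finite_props unfolding valid_def by blast
    qed
  qed
  then obtain t where "(grow L {})\<^sup>*\<^sup>* (Node (A, \<phi>) []) t"
    and "\<forall>b\<in>branches t. closed_set (set b)"
    by (auto simp: closable_def)
  then have "tableau L \<phi> t \<and> closed_tableau t"
    using tableau_rtranclp tableau.root unfolding A_def
    by (fastforce simp: closed_tableau_def closed_branch_iff)
  then show ?thesis
    by blast
qed

end
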